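(* Suppose there exist $L>0$, $\mu>0$ and $\sigma>0$ such that for all $\theta\in\mathbb{R}^p$: (i) $\|H(\theta)\|_2\le L$; (ii) $\|\nabla\mathcal{L}(\theta)\|^2\ge2\mu\,\mathcal{L}(\theta)$; (iii) $\frac1n\sum_{i=1}^n\|\nabla\ell_i(\theta)-\nabla\mathcal{L}(\theta)\|^2\le\sigma^2\mathcal{L}(\theta)$. Let $\{\theta^t\}_{t\ge0}$ be the iterates of stochastic SAM with learning rate $\eta>0$, perturbation radius $\rho\ge0$ and batch size $B\ge1$, started at $\theta^0\in\mathbb{R}^p$. If $$\eta\le\min\left\{\frac{1}{2L},\frac{\mu B}{2L\sigma^2}\right\},\qquad \rho\le\min\left\{\frac{1}{4L},\frac{\mu B}{4L\sigma^2},\frac{\eta\mu^2}{24L^2}\right\},$$ then $$\mathbb{E}\big[\mathcal{L}(\theta^t)\big]\le\left(1-\frac{\eta\mu}{2}\right)^t\mathcal{L}(\theta^0)\qquad\text{for all }t\in\mathbb{N}.$$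
   Context: **Model and loss.** Training data $(x_i,y_i)_{i=1}^n$ with $x_i\in\mathbb{R}^d$, $y_i\in\mathbb{R}$; a model $f(x;\theta)\in\mathbb{R}$ with parameters $\theta\in\mathbb{R}^p$, where each $\theta\mapsto f(x_i;\theta)$ is twice differentiable. $\ell_i(\theta)=\frac12|f(x_i;\theta)-y_i|^2$ and $\mathcal{L}(\theta)=\frac1n\sum_{i=1}^n\ell_i(\theta)$. The over-parameterized case is assumed: $\min_\theta\mathcal{L}(\theta)=0$. $H(\theta)=\nabla^2\mathcal{L}(\theta)$ is the Hessian and $\|\cdot\|_2$ the spectral norm. **Stochastic SAM.** For a batch $\xi=(\xi_1,\dots,\xi_B)$ of indices in $\{1,\dots,n\}$, put $\mathcal{L}_\xi(\theta)=\frac1B\sum_{j=1}^B\ell_{\xi_j}(\theta)$. Stochastic SAM is the iteration $$\theta^{t+1}=\theta^t-\eta\nabla\mathcal{L}_{\xi_t^1}\big(\theta^t+\rho\nabla\mathcal{L}_{\xi_t^2}(\theta^t)\big),\qquad t=0,1,2,\dots,$$ where all batches $\xi_t^1,\xi_t^2$ ($t\ge0$) are mutually independent and each consists of $B$ indices drawn independently and uniformly from $\{1,\dots,n\}$. The expectation $\mathbb{E}$ is over these random batches, with $\theta^0$ deterministic. *)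

theory Defs
  imports "HOL-Probability.Probability"
begin

definition gradient :: "('a::real_inner \<Rightarrow> real) \<Rightarrow> 'a \<Rightarrow> 'a" where
  "gradient F \<theta> = (THE g. GDERIV F \<theta> :> g)"

definition hessian :: "(real^'p \<Rightarrow> real) \<Rightarrow> real^'p \<Rightarrow> real^'p^'p" where
  "hessian F \<theta> = jacobian (gradient F) (at \<theta>)"

text \<open>Pointwise existence of the second derivative; no continuity of it is required.\<close>

definition twice_differentiable :: "(real^'p \<Rightarrow> real) \<Rightarrow> bool" where
  "twice_differentiable F \<longleftrightarrow>
     (\<forall>\<theta>. F differentiable (at \<theta>)) \<and> (\<forall>\<theta>. gradient F differentiable (at \<theta>))"

definition spectral_norm :: "real^'m^'n \<Rightarrow> real" where
  "spectral_norm A = onorm (\<lambda>v. A *v v)"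

definition sample_loss ::
  "(real^'d \<Rightarrow> real^'p \<Rightarrow> real) \<Rightarrow> (nat \<Rightarrow> real^'d) \<Rightarrow> (nat \<Rightarrow> real) \<Rightarrow> nat \<Rightarrow> real^'p \<Rightarrow> real" where
  "sample_loss f x y i \<theta> = 1 / 2 * \<bar>f (x i) \<theta> - y i\<bar>\<^sup>2"

definition loss ::
  "(real^'d \<Rightarrow> real^'p \<Rightarrow> real) \<Rightarrow> (nat \<Rightarrow> real^'d) \<Rightarrow> (nat \<Rightarrow> real) \<Rightarrow> nat \<Rightarrow> real^'p \<Rightarrow> real" where
  "loss f x y n \<theta> = 1 / real n * (\<Sum>i=1..n. sample_loss f x y i \<theta>)"

text \<open>A batch is a function on the positions \<open>1, \<dots>, B\<close>; its values elsewhere are irrelevant.\<close>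

definition batch_loss ::
  "(real^'d \<Rightarrow> real^'p \<Rightarrow> real) \<Rightarrow> (nat \<Rightarrow> real^'d) \<Rightarrow> (nat \<Rightarrow> real) \<Rightarrow> nat \<Rightarrow> (nat \<Rightarrow> nat)
     \<Rightarrow> real^'p \<Rightarrow> real" where
  "batch_loss f x y B b \<theta> = 1 / real B * (\<Sum>j=1..B. sample_loss f x y (b j) \<theta>)"

text \<open>\<open>\<xi> 1 t\<close> is the batch of the outer (descent) gradient of step \<open>t\<close>, and \<open>\<xi> 2 t\<close> that of the
  inner (perturbation) gradient.\<close>

primrec stochastic_sam ::
  "(real^'d \<Rightarrow> real^'p \<Rightarrow> real) \<Rightarrow> (nat \<Rightarrow> real^'d) \<Rightarrow> (nat \<Rightarrow> real) \<Rightarrow> nat \<Rightarrow> real \<Rightarrow> real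
     \<Rightarrow> real^'p \<Rightarrow> (nat \<Rightarrow> nat \<Rightarrow> nat \<Rightarrow> nat) \<Rightarrow> nat \<Rightarrow> real^'p" where
  "stochastic_sam f x y B \<eta> \<rho> \<theta>0 \<xi> 0 = \<theta>0"
| "stochastic_sam f x y B \<eta> \<rho> \<theta>0 \<xi> (Suc t) =
     (let \<theta> = stochastic_sam f x y B \<eta> \<rho> \<theta>0 \<xi> t
      in \<theta> - \<eta> *\<^sub>R gradient (batch_loss f x y B (\<xi> 1 t))
                (\<theta> + \<rho> *\<^sub>R gradient (batch_loss f x y B (\<xi> 2 t)) \<theta>))"

text \<open>\<open>\<xi> s t j \<omega>\<close> is the \<open>j\<close>-th index of batch \<open>s\<close> of step \<open>t\<close>. The first condition makes the whole
  batches, as random vectors, mutually independent; the restriction to \<open>{1..B}\<close> is only there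
  because elements of a product space are extensional functions. The other two conditions make
  the entries of each batch independent and uniform on \<open>{1..n}\<close>.\<close>

definition (in prob_space) independent_uniform_batches ::
  "nat \<Rightarrow> nat \<Rightarrow> (nat \<Rightarrow> nat \<Rightarrow> nat \<Rightarrow> 'a \<Rightarrow> nat) \<Rightarrow> bool" where
  "independent_uniform_batches n B \<xi> \<longleftrightarrow>
     indep_vars (\<lambda>_. \<Pi>\<^sub>M j\<in>{1..B}. count_space {1..n})
       (\<lambda>(s, t) \<omega>. \<lambda>j\<in>{1..B}. \<xi> s t j \<omega>) ({1, 2} \<times> UNIV) \<and>
     (\<forall>s\<in>{1, 2}. \<forall>t.
        indep_vars (\<lambda>_. count_space {1..n}) (\<xi> s t) {1..B} \<and>
        (\<forall>j\<in>{1..B}. distr M (count_space {1..n}) (\<xi> s t j) = uniform_count_measure {1..n}))"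

end

theory Submission
  imports Defs
begin

text \<open>Write \<open>G\<close> for the full gradient, \<open>u\<close> for the perturbed point of a step from \<open>\<theta>\<close>. Averaging the
  descent lemma over the outer batch and polarising \<open>G \<theta> \<bullet> G u\<close> bounds the new loss by
  \<open>F \<theta> - \<eta>/2 \<bar>G \<theta>\<bar>\<^sup>2 + \<eta>/2 \<bar>G u - G \<theta>\<bar>\<^sup>2\<close>: the noise at \<open>u\<close> is controlled by \<open>F u\<close>, hence by
  \<open>\<bar>G u\<bar>\<^sup>2\<close>. As \<open>G\<close> is \<open>L\<close>-Lipschitz, the last term is at most \<open>\<eta>/2 (L \<rho>)\<^sup>2\<close> times the squared norm
  of the inner batch gradient, whose mean is a small multiple of \<open>\<bar>G \<theta>\<bar>\<^sup>2 + \<mu> F \<theta>\<close>, and the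
  Polyak-Lojasiewicz inequality leaves the contraction factor \<open>1 - \<eta> \<mu> / 2\<close>. All random variables have finite
  range, so the successive averaging over independent batches is a finite Fubini argument.\<close>

section \<open>Gradients and second differentiability of the losses\<close>

lemma gradient_eqI:
  assumes "GDERIV F \<theta> :> g"
  shows "gradient F \<theta> = g"
  unfolding gradient_def
proof (rule the_equality)
  show "GDERIV F \<theta> :> g" by (fact assms)
next
  fix g' assume "GDERIV F \<theta> :> g'"
  then have "(\<lambda>h. h \<bullet> g') = (\<lambda>h. h \<bullet> g)"
    using assms unfolding gderiv_def by (rule has_derivative_unique)
  then show "g' = g"
    using inner_eq_zero_iff[of "g' - g"] by (simp add: fun_eq_iff inner_diff_right)
qed

lemma GDERIV_gradient:
  fixes F :: "'a::euclidean_space \<Rightarrow> real"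
  assumes "F differentiable (at \<theta>)"
  shows "GDERIV F \<theta> :> gradient F \<theta>"
proof -
  obtain D where D: "(F has_derivative D) (at \<theta>)"
    using assms by (auto simp: differentiable_def)
  then have "linear D"
    by (rule has_derivative_linear)
  \<comment> \<open>Riesz representation: the adjoint of the functional \<open>D\<close>, evaluated
    at 1, is the representing vector.\<close>
  then have "D = (\<lambda>h. h \<bullet> adjoint D 1)"
    using adjoint_works[of D _ 1] by (simp add: fun_eq_iff)
  with D have "GDERIV F \<theta> :> adjoint D 1"
    unfolding gderiv_def by simp
  then show ?thesis
    by (simp add: gradient_eqI)
qed

lemma twice_differentiableI:
  assumes "\<And>\<theta>. GDERIV F \<theta> :> G \<theta>" and "\<And>\<theta>. G differentiable (at \<theta>)"
  shows "twice_differentiable F"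
proof -
  have "gradient F = G"
    using assms(1) gradient_eqI by blast
  then show ?thesis
    using assms unfolding twice_differentiable_def gderiv_def differentiable_def by blast
qed

text \<open>The gradient is the residual times the gradient of the model output, a product of two
  differentiable maps.\<close>

lemma twice_differentiable_sample_loss:
  assumes "twice_differentiable (f (x i))"
  shows "twice_differentiable (sample_loss f x y i)"
proof (rule twice_differentiableI)
  fix \<theta>
  have D: "\<And>\<theta>. f (x i) differentiable (at \<theta>)" "\<And>\<theta>. gradient (f (x i)) differentiable (at \<theta>)"
    using assms unfolding twice_differentiable_def by auto
  have 1: "(f (x i) has_derivative (\<lambda>h. h \<bullet> gradient (f (x i)) \<theta>)) (at \<theta>)"
    using GDERIV_gradient[OF D(1)] unfolding gderiv_def .
  have "((\<lambda>\<theta>. 1 / 2 * (f (x i) \<theta> - y i)\<^sup>2) has_derivative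
      (\<lambda>h. h \<bullet> ((f (x i) \<theta> - y i) *\<^sub>R gradient (f (x i)) \<theta>))) (at \<theta>)"
    by (rule derivative_eq_intros 1 refl)+ (auto simp: algebra_simps)
  then show "GDERIV (sample_loss f x y i) \<theta> :> (f (x i) \<theta> - y i) *\<^sub>R gradient (f (x i)) \<theta>"
    unfolding gderiv_def sample_loss_def[abs_def] by simp
  show "(\<lambda>\<theta>. (f (x i) \<theta> - y i) *\<^sub>R gradient (f (x i)) \<theta>) differentiable (at \<theta>)"
    using D[of \<theta>] by (intro differentiable_scaleR differentiable_diff) auto
qed

lemma
  assumes "\<And>j. j \<in> {1..B} \<Longrightarrow> twice_differentiable (f (x (b j)))"
  shows gradient_batch_loss: "gradient (batch_loss f x y B b) \<theta> =
      (1 / real B) *\<^sub>R (\<Sum>j=1..B. gradient (sample_loss f x y (b j)) \<theta>)"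
    and twice_differentiable_batch_loss: "twice_differentiable (batch_loss f x y B b)"
proof -
  define g where "g = (\<lambda>j. gradient (sample_loss f x y (b j)))"
  have td: "twice_differentiable (sample_loss f x y (b j))" if "j \<in> {1..B}" for j
    using twice_differentiable_sample_loss assms that by blast
  have "GDERIV (sample_loss f x y (b j)) \<theta> :> g j \<theta>" if "j \<in> {1..B}" for j \<theta>
    using GDERIV_gradient td[OF that] unfolding twice_differentiable_def g_def by blast
  then have 1: "(sample_loss f x y (b j) has_derivative (\<lambda>h. h \<bullet> g j \<theta>)) (at \<theta>)" if "j \<in> {1..B}" for j \<theta>
    using that unfolding gderiv_def by blast
  have 2: "GDERIV (batch_loss f x y B b) \<theta> :> (1 / real B) *\<^sub>R (\<Sum>j=1..B. g j \<theta>)" for \<theta>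
    unfolding gderiv_def batch_loss_def[abs_def]
  proof -
    have "((\<lambda>\<theta>. 1 / real B * (\<Sum>j=1..B. sample_loss f x y (b j) \<theta>)) has_derivative
        (\<lambda>h. 1 / real B * (\<Sum>j=1..B. h \<bullet> g j \<theta>))) (at \<theta>)"
      by (intro has_derivative_mult_right has_derivative_sum 1)
    then show "((\<lambda>\<theta>. 1 / real B * (\<Sum>j=1..B. sample_loss f x y (b j) \<theta>)) has_derivative
        (\<lambda>h. h \<bullet> ((1 / real B) *\<^sub>R (\<Sum>j=1..B. g j \<theta>)))) (at \<theta>)"
      by (simp add: inner_sum_right)
  qed
  have g_differentiable: "g j differentiable (at \<theta>)" if "j \<in> {1..B}" for j \<theta>
    using td[OF that] unfolding g_def twice_differentiable_def by blast
  show "gradient (batch_loss f x y B b) \<theta> =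
      (1 / real B) *\<^sub>R (\<Sum>j=1..B. gradient (sample_loss f x y (b j)) \<theta>)"
    using gradient_eqI[OF 2] unfolding g_def by simp
  show "twice_differentiable (batch_loss f x y B b)"
  proof (rule twice_differentiableI[OF 2])
    fix \<theta>
    show "(\<lambda>\<theta>. (1 / real B) *\<^sub>R (\<Sum>j=1..B. g j \<theta>)) differentiable (at \<theta>)"
      using g_differentiable
      by (intro differentiable_scaleR differentiable_const differentiable_sum finite_atLeastAtMost ballI)
  qed
qed

text \<open>The batch of size \<open>n\<close> that lists every index once makes the facts about
  batch losses available for the full loss.\<close>

lemma loss_eq_batch_loss: "loss f x y n = batch_loss f x y n id"
  unfolding loss_def[abs_def] batch_loss_def[abs_def] by simp

text \<open>This makes a batch interchangeable with its restriction to \<open>{1..B}\<close>, the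
  form in which independence of whole batches is given.\<close>

lemma gradient_batch_loss_cong:
  assumes "\<And>j. j \<in> {1..B} \<Longrightarrow> b j = b' j"
  shows "gradient (batch_loss f x y B b) = gradient (batch_loss f x y B b')"
proof -
  have "batch_loss f x y B b = batch_loss f x y B b'"
    using assms unfolding batch_loss_def[abs_def] by simp
  then show ?thesis by simp
qed

section \<open>Smoothness: Lipschitz gradient and descent lemma\<close>

text \<open>The Hessian is the derivative of the gradient map, so the mean value inequality turns
  its uniform operator norm bound into a Lipschitz constant. Pointwise existence of the second
  derivative suffices.\<close>

lemma gradient_lipschitz:
  assumes "twice_differentiable F" and "\<And>\<theta>. spectral_norm (hessian F \<theta>) \<le> L"
  shows "norm (gradient F \<theta> - gradient F \<theta>') \<le> L * norm (\<theta> - \<theta>')"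
proof (rule differentiable_bound)
  show "(gradient F has_derivative (\<lambda>h. hessian F u *v h)) (at u within UNIV)" for u
    using assms(1) unfolding twice_differentiable_def hessian_def by (auto simp flip: jacobian_works)
  show "onorm (\<lambda>h. hessian F u *v h) \<le> L" for u
    using assms(2) unfolding spectral_norm_def .
qed auto

text \<open>Instead of integrating along the segment, compare derivatives: by Cauchy-Schwarz and the
  Lipschitz bound, \<open>\<phi>\<close>, which is \<open>F\<close> along \<open>v\<close> minus its
  first-order and quadratic terms, has nonpositive derivative for s \<ge> 0.\<close>

lemma descent_lemma:
  fixes F :: "real^'p \<Rightarrow> real"
  assumes "\<And>\<theta>. F differentiable (at \<theta>)"
    and lip: "\<And>\<theta> \<theta>'. norm (gradient F \<theta> - gradient F \<theta>') \<le> L * norm (\<theta> - \<theta>')"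
  shows "F (\<theta> + v) \<le> F \<theta> + v \<bullet> gradient F \<theta> + L / 2 * (norm v)\<^sup>2"
proof -
  define \<phi> where "\<phi> = (\<lambda>s. F (\<theta> + s *\<^sub>R v) - s * (v \<bullet> gradient F \<theta>) - L / 2 * s\<^sup>2 * (norm v)\<^sup>2)"
  have "\<phi> 1 \<le> \<phi> 0"
  proof (rule DERIV_nonpos_imp_nonincreasing[where f = \<phi>])
    fix s :: real assume s: "0 \<le> s"
    have F: "(F has_derivative (\<lambda>h. h \<bullet> gradient F (\<theta> + s *\<^sub>R v))) (at (\<theta> + s *\<^sub>R v))"
      using GDERIV_gradient[OF assms(1)] unfolding gderiv_def .
    have "((\<lambda>s. F (\<theta> + s *\<^sub>R v)) has_derivative (\<lambda>r. (r *\<^sub>R v) \<bullet> gradient F (\<theta> + s *\<^sub>R v))) (at s)"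
      by (rule has_derivative_compose[where f = "\<lambda>s. \<theta> + s *\<^sub>R v"]) (auto intro!: derivative_eq_intros F)
    then have "((\<lambda>s. F (\<theta> + s *\<^sub>R v)) has_real_derivative (v \<bullet> gradient F (\<theta> + s *\<^sub>R v))) (at s)"
      by (simp add: has_field_derivative_def mult_commute_abs)
    then have "(\<phi> has_real_derivative
        v \<bullet> gradient F (\<theta> + s *\<^sub>R v) - v \<bullet> gradient F \<theta> - L * s * (norm v)\<^sup>2) (at s)"
      unfolding \<phi>_def by (auto intro!: derivative_eq_intros)
    moreover have "v \<bullet> (gradient F (\<theta> + s *\<^sub>R v) - gradient F \<theta>) \<le> norm v * (L * norm (s *\<^sub>R v))"
      using norm_cauchy_schwarz[of v "gradient F (\<theta> + s *\<^sub>R v) - gradient F \<theta>"]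
        mult_left_mono[OF lip[of "\<theta> + s *\<^sub>R v" \<theta>], of "norm v"] by simp
    then have "v \<bullet> gradient F (\<theta> + s *\<^sub>R v) - v \<bullet> gradient F \<theta> - L * s * (norm v)\<^sup>2 \<le> 0"
      using s by (simp add: inner_diff_right power2_eq_square mult_ac)
    ultimately show "\<exists>d. (\<phi> has_real_derivative d) (at s) \<and> d \<le> 0" by blast
  qed simp
  then show ?thesis unfolding \<phi>_def by simp
qed

section \<open>Expectations of random variables with finite range\<close>

context prob_space
begin

text \<open>On \<open>space M\<close> the composite is a finite linear combination of indicators of
  the level sets of \<open>X\<close>, for every function \<open>g\<close>.\<close>

lemma
  fixes g :: "'b \<Rightarrow> real"
  assumes X: "X \<in> measurable M (count_space A)" and "finite A"
  shows integrable_finite_range: "integrable M (\<lambda>\<omega>. g (X \<omega>))"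
    and expectation_finite_range:
      "expectation (\<lambda>\<omega>. g (X \<omega>)) = (\<Sum>a\<in>A. g a * prob (X -` {a} \<inter> space M))"
proof -
  have ev: "X -` {a} \<inter> space M \<in> events" if "a \<in> A" for a
    using measurable_sets[OF X, of "{a}"] that by simp
  have XA: "X \<omega> \<in> A" if "\<omega> \<in> space M" for \<omega>
    using measurable_space[OF X that] by simp
  have eq: "g (X \<omega>) = (\<Sum>a\<in>A. g a * indicator (X -` {a} \<inter> space M) \<omega>)" if "\<omega> \<in> space M" for \<omega>
    using that XA[OF that] \<open>finite A\<close>
    by (simp add: indicator_def sum.delta' if_distrib[of "\<lambda>u. _ * u"] cong: if_cong)
  have int: "integrable M (\<lambda>\<omega>. g a * indicator (X -` {a} \<inter> space M) \<omega>)" if "a \<in> A" for a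
    using ev[OF that] by (intro integrable_mult_right) (simp add: emeasure_eq_measure)
  have "integrable M (\<lambda>\<omega>. \<Sum>a\<in>A. g a * indicator (X -` {a} \<inter> space M) \<omega>)"
    using int by (rule Bochner_Integration.integrable_sum)
  then show "integrable M (\<lambda>\<omega>. g (X \<omega>))"
    using eq by (simp cong: Bochner_Integration.integrable_cong)
  have "expectation (\<lambda>\<omega>. g (X \<omega>)) =
      expectation (\<lambda>\<omega>. \<Sum>a\<in>A. g a * indicator (X -` {a} \<inter> space M) \<omega>)"
    by (intro Bochner_Integration.integral_cong refl eq)
  also have "\<dots> = (\<Sum>a\<in>A. expectation (\<lambda>\<omega>. g a * indicator (X -` {a} \<inter> space M) \<omega>))"
    using int by (rule Bochner_Integration.integral_sum)
  also have "\<dots> = (\<Sum>a\<in>A. g a * prob (X -` {a} \<inter> space M))"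
    using ev by (intro sum.cong refl) simp
  finally show "expectation (\<lambda>\<omega>. g (X \<omega>)) = (\<Sum>a\<in>A. g a * prob (X -` {a} \<inter> space M))" .
qed

text \<open>Finite Fubini: independence factors the probability of each pair of values, and the
  double sum is regrouped. The inner expectation freezes \<open>X\<close> and runs over a fresh
  outcome \<open>\<omega>'\<close>.\<close>

lemma expectation_indep_finite_range:
  fixes g :: "'b \<Rightarrow> 'b \<Rightarrow> real"
  assumes ind: "indep_var (count_space A) X (count_space D) Y" and "finite A" "finite D"
  shows "expectation (\<lambda>\<omega>. g (X \<omega>) (Y \<omega>)) = expectation (\<lambda>\<omega>. expectation (\<lambda>\<omega>'. g (X \<omega>) (Y \<omega>')))"
proof -
  have X: "X \<in> measurable M (count_space A)" and Y: "Y \<in> measurable M (count_space D)"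
    using ind by (auto dest: indep_var_rv1 indep_var_rv2)
  have XY: "(\<lambda>\<omega>. (X \<omega>, Y \<omega>)) \<in> measurable M (count_space (A \<times> D))"
    using measurable_Pair[OF X Y] assms(2,3) by (simp add: pair_measure_count_space)
  have prod: "prob ((\<lambda>\<omega>. (X \<omega>, Y \<omega>)) -` {(a, d)} \<inter> space M) =
      prob (X -` {a} \<inter> space M) * prob (Y -` {d} \<inter> space M)" if "a \<in> A" "d \<in> D" for a d
    using indep_varD[OF ind, of "{a}" "{d}"] that by simp
  have "expectation (\<lambda>\<omega>. g (X \<omega>) (Y \<omega>)) =
      (\<Sum>(a, d)\<in>A \<times> D. g a d * (prob (X -` {a} \<inter> space M) * prob (Y -` {d} \<inter> space M)))"
    using expectation_finite_range[OF XY, of "\<lambda>(a, d). g a d"] assms(2,3)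
    by (auto simp: prod intro!: sum.cong)
  also have "\<dots> = (\<Sum>a\<in>A. (\<Sum>d\<in>D. g a d * prob (Y -` {d} \<inter> space M)) * prob (X -` {a} \<inter> space M))"
    by (simp add: sum.cartesian_product[symmetric] sum_distrib_right sum_distrib_left mult_ac)
  also have "\<dots> = expectation (\<lambda>\<omega>. expectation (\<lambda>\<omega>'. g (X \<omega>) (Y \<omega>')))"
    unfolding expectation_finite_range[OF Y \<open>finite D\<close>]
    by (rule expectation_finite_range[OF X \<open>finite A\<close>, symmetric])
  finally show ?thesis .
qed

lemma expectation_uniform:
  fixes g :: "'b \<Rightarrow> real"
  assumes X: "X \<in> measurable M (count_space A)" and "finite A"
    and "distr M (count_space A) X = uniform_count_measure A"
  shows "expectation (\<lambda>\<omega>. g (X \<omega>)) = (\<Sum>a\<in>A. g a) / real (card A)"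
proof -
  have "expectation (\<lambda>\<omega>. g (X \<omega>)) = integral\<^sup>L (distr M (count_space A) X) g"
    by (rule integral_distr[OF X, symmetric]) simp
  also have "\<dots> = (\<Sum>a\<in>A. g a) / real (card A)"
    unfolding assms(3) by (rule integral_uniform_count_measure[OF \<open>finite A\<close>])
  finally show ?thesis .
qed

text \<open>Unbiasedness is linearity. For the second moment, the squared norm of the sum expands
  into \<open>B\<^sup>2\<close> pairs, each contributing the squared norm of \<open>G\<close>; by
  independence only the \<open>B\<close> diagonal pairs add the variance \<open>V\<close>, so after
  normalising \<open>V / B\<close> remains.\<close>

lemma
  fixes g :: "nat \<Rightarrow> 'v::real_inner" and X :: "nat \<Rightarrow> 'a \<Rightarrow> nat"
  assumes ind: "indep_vars (\<lambda>_. count_space {1..n}) X {1..B}"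
    and unif: "\<And>j. j \<in> {1..B} \<Longrightarrow> distr M (count_space {1..n}) (X j) = uniform_count_measure {1..n}"
    and "1 \<le> n" "1 \<le> B"
    and G: "G = (1 / real n) *\<^sub>R (\<Sum>i=1..n. g i)"
  shows expectation_inner_batch_mean:
      "expectation (\<lambda>\<omega>. v \<bullet> ((1 / real B) *\<^sub>R (\<Sum>j=1..B. g (X j \<omega>)))) = v \<bullet> G"
    and expectation_norm2_batch_mean:
      "expectation (\<lambda>\<omega>. (norm ((1 / real B) *\<^sub>R (\<Sum>j=1..B. g (X j \<omega>))))\<^sup>2) =
        (norm G)\<^sup>2 + (1 / real n * (\<Sum>i=1..n. (norm (g i - G))\<^sup>2)) / real B"
proof -
  define V where "V = 1 / real n * (\<Sum>i=1..n. (norm (g i - G))\<^sup>2)"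
  have X: "X j \<in> measurable M (count_space {1..n})" if "j \<in> {1..B}" for j
    using ind that by (auto simp: indep_vars_def)
  have sumg: "(\<Sum>i=1..n. g i) = real n *\<^sub>R G"
    using G \<open>1 \<le> n\<close> by simp
  have single: "expectation (\<lambda>\<omega>. w \<bullet> g (X j \<omega>)) = w \<bullet> G" if "j \<in> {1..B}" for j w
    using expectation_uniform[OF X[OF that] _ unif[OF that], of "\<lambda>i. w \<bullet> g i"] \<open>1 \<le> n\<close>
    by (simp add: G flip: inner_sum_right)
  have int: "integrable M (\<lambda>\<omega>. w \<bullet> g (X j \<omega>))" if "j \<in> {1..B}" for j w
    using integrable_finite_range[OF X[OF that], of "\<lambda>i. w \<bullet> g i"] by simp
  have "expectation (\<lambda>\<omega>. \<Sum>j=1..B. v \<bullet> g (X j \<omega>)) = real B * (v \<bullet> G)"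
    using int single by (subst Bochner_Integration.integral_sum) auto
  then show "expectation (\<lambda>\<omega>. v \<bullet> ((1 / real B) *\<^sub>R (\<Sum>j=1..B. g (X j \<omega>)))) = v \<bullet> G"
    using \<open>1 \<le> B\<close> by (simp add: inner_sum_right)
  have pairs: "expectation (\<lambda>\<omega>. g (X j \<omega>) \<bullet> g (X k \<omega>)) = (norm G)\<^sup>2 + (if j = k then V else 0)"
    and intp: "integrable M (\<lambda>\<omega>. g (X j \<omega>) \<bullet> g (X k \<omega>))"
    if jk: "j \<in> {1..B}" "k \<in> {1..B}" for j k
  proof -
    have XX: "(\<lambda>\<omega>. (X j \<omega>, X k \<omega>)) \<in> measurable M (count_space ({1..n} \<times> {1..n}))"
      using measurable_Pair[OF X[OF jk(1)] X[OF jk(2)]] by (simp add: pair_measure_count_space)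
    show "integrable M (\<lambda>\<omega>. g (X j \<omega>) \<bullet> g (X k \<omega>))"
      using integrable_finite_range[OF XX, of "\<lambda>(i, l). g i \<bullet> g l"] by simp
    show "expectation (\<lambda>\<omega>. g (X j \<omega>) \<bullet> g (X k \<omega>)) = (norm G)\<^sup>2 + (if j = k then V else 0)"
    proof (cases "j = k")
      case True
      \<comment> \<open>Second moment equals squared mean plus variance; the cross term is evaluated
        by \<open>sumg\<close>.\<close>
      have "(\<Sum>i=1..n. (norm (g i - G))\<^sup>2) =
          (\<Sum>i=1..n. (norm (g i))\<^sup>2) - 2 * ((\<Sum>i=1..n. g i) \<bullet> G) + real n * (norm G)\<^sup>2"
        by (simp add: power2_norm_eq_inner inner_diff_left inner_diff_right inner_commute
            sum.distrib sum_subtractf inner_sum_left inner_sum_right sum_distrib_left algebra_simps)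
      then have "(\<Sum>i=1..n. (norm (g i))\<^sup>2) / real n = (norm G)\<^sup>2 + V"
        using \<open>1 \<le> n\<close> unfolding V_def sumg by (simp add: field_simps power2_norm_eq_inner)
      then show ?thesis
        using True expectation_uniform[OF X[OF jk(1)] _ unif[OF jk(1)], of "\<lambda>i. (norm (g i))\<^sup>2"]
        by (simp add: power2_norm_eq_inner)
    next
      case False
      \<comment> \<open>Restricting the family to two singletons and evaluating there extracts
        pairwise independence.\<close>
      have "indep_var (PiM {j} (\<lambda>_. count_space {1..n})) (\<lambda>\<omega>. restrict (\<lambda>i. X i \<omega>) {j})
          (PiM {k} (\<lambda>_. count_space {1..n})) (\<lambda>\<omega>. restrict (\<lambda>i. X i \<omega>) {k})"
        using False jk by (intro indep_var_restrict[OF ind]) auto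
      then have "indep_var (count_space {1..n}) ((\<lambda>h. h j) \<circ> (\<lambda>\<omega>. restrict (\<lambda>i. X i \<omega>) {j}))
          (count_space {1..n}) ((\<lambda>h. h k) \<circ> (\<lambda>\<omega>. restrict (\<lambda>i. X i \<omega>) {k}))"
        by (rule indep_var_compose) (auto intro: measurable_component_singleton)
      then have "indep_var (count_space {1..n}) (X j) (count_space {1..n}) (X k)"
        by (simp add: comp_def)
      from expectation_indep_finite_range[OF this, of "\<lambda>i l. g i \<bullet> g l"]
      have "expectation (\<lambda>\<omega>. g (X j \<omega>) \<bullet> g (X k \<omega>)) = expectation (\<lambda>\<omega>. g (X j \<omega>) \<bullet> G)"
        using single[OF jk(2)] by simp
      then show ?thesis
        using single[OF jk(1), of G] False by (simp add: inner_commute power2_norm_eq_inner)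
    qed
  qed
  have "expectation (\<lambda>\<omega>. \<Sum>j=1..B. \<Sum>k=1..B. g (X j \<omega>) \<bullet> g (X k \<omega>)) =
      (\<Sum>j=1..B. expectation (\<lambda>\<omega>. \<Sum>k=1..B. g (X j \<omega>) \<bullet> g (X k \<omega>)))"
    by (intro Bochner_Integration.integral_sum Bochner_Integration.integrable_sum intp)
  also have "\<dots> = (\<Sum>j=1..B. \<Sum>k=1..B. expectation (\<lambda>\<omega>. g (X j \<omega>) \<bullet> g (X k \<omega>)))"
    by (intro sum.cong refl Bochner_Integration.integral_sum intp)
  also have "\<dots> = (\<Sum>j=1..B. \<Sum>k=1..B. (norm G)\<^sup>2 + (if j = k then V else 0))"
    by (intro sum.cong refl pairs)
  also have "\<dots> = (real B)\<^sup>2 * (norm G)\<^sup>2 + real B * V"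
    by (simp add: sum.distrib power2_eq_square distrib_left mult.assoc)
  finally have "expectation (\<lambda>\<omega>. (norm (\<Sum>j=1..B. g (X j \<omega>)))\<^sup>2) = (real B)\<^sup>2 * (norm G)\<^sup>2 + real B * V"
    by (simp add: power2_norm_eq_inner inner_sum_left inner_sum_right inner_commute)
  then have "expectation (\<lambda>\<omega>. (norm ((1 / real B) *\<^sub>R (\<Sum>j=1..B. g (X j \<omega>))))\<^sup>2) =
      ((real B)\<^sup>2 * (norm G)\<^sup>2 + real B * V) / (real B)\<^sup>2"
    by (simp add: power_divide)
  also have "\<dots> = (norm G)\<^sup>2 + V / real B"
    using \<open>1 \<le> B\<close> by (simp add: add_divide_distrib power2_eq_square)
  finally show "expectation (\<lambda>\<omega>. (norm ((1 / real B) *\<^sub>R (\<Sum>j=1..B. g (X j \<omega>))))\<^sup>2) =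
      (norm G)\<^sup>2 + V / real B" .
qed


text \<open>A finite product of finite discrete spaces is discrete, so a whole batch is a single
  variable of finite range.\<close>

lemma measurable_batch:
  assumes "indep_vars (\<lambda>_. count_space {1..n::nat}) X {1..B::nat}"
  shows "(\<lambda>\<omega>. \<lambda>j\<in>{1..B}. X j \<omega>) \<in> measurable M (count_space ({1..B} \<rightarrow>\<^sub>E {1..n}))"
proof -
  have "(\<lambda>\<omega>. \<lambda>j\<in>{1..B}. X j \<omega>) \<in> measurable M (PiM {1..B} (\<lambda>_. count_space {1..n}))"
    using assms by (intro measurable_restrict) (auto simp: indep_vars_def)
  then show ?thesis
    by (simp add: count_space_PiM_finite)
qed

end

section \<open>One step of stochastic SAM from a fixed point\<close>

text \<open>The one-step analysis sees only the objective and its sample gradients, not the model.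
  The bounds on \<open>\<eta>\<close> and \<open>\<rho>\<close> are cleared of denominators so that
  they can be multiplied directly into the noise estimates.\<close>

locale sam_objective = prob_space M for M :: "'w measure" +
  fixes F :: "real^'p \<Rightarrow> real" and g :: "nat \<Rightarrow> real^'p \<Rightarrow> real^'p" and n B :: nat
    and L \<mu> \<sigma> \<eta> \<rho> :: real
  assumes n_pos: "1 \<le> n" and B_pos: "1 \<le> B"
    and L_pos: "0 < L" and \<mu>_pos: "0 < \<mu>" and \<eta>_pos: "0 < \<eta>" and \<rho>_nonneg: "0 \<le> \<rho>"
    and F_nonneg: "0 \<le> F \<theta>"
    and F_differentiable: "F differentiable (at \<theta>)"
    and F_lipschitz: "norm (gradient F \<theta> - gradient F \<theta>') \<le> L * norm (\<theta> - \<theta>')"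
    and gradient_F: "gradient F \<theta> = (1 / real n) *\<^sub>R (\<Sum>i=1..n. g i \<theta>)"
    and PL: "2 * \<mu> * F \<theta> \<le> (norm (gradient F \<theta>))\<^sup>2"
    and noise: "1 / real n * (\<Sum>i=1..n. (norm (g i \<theta> - gradient F \<theta>))\<^sup>2) \<le> \<sigma>\<^sup>2 * F \<theta>"
    and \<eta>_le: "L * \<eta> \<le> 1 / 2" "L * \<eta> * \<sigma>\<^sup>2 \<le> \<mu> * real B / 2"
    and \<rho>_le: "L * \<rho> \<le> 1 / 4" "L * \<rho> * \<sigma>\<^sup>2 \<le> \<mu> * real B / 4"
begin

abbreviation batch_grad :: "(nat \<Rightarrow> nat) \<Rightarrow> real^'p \<Rightarrow> real^'p" where
  "batch_grad b \<theta> \<equiv> (1 / real B) *\<^sub>R (\<Sum>j=1..B. g (b j) \<theta>)"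

text \<open>This is the interface between the two averagings: the outer batch is gone, and the inner
  one enters only through \<open>u\<close>.\<close>

definition perturbed_bound :: "real^'p \<Rightarrow> real^'p \<Rightarrow> real" where
  "perturbed_bound \<theta> u =
     F \<theta> - \<eta> / 2 * (norm (gradient F \<theta>))\<^sup>2 + \<eta> / 2 * (norm (gradient F u - gradient F \<theta>))\<^sup>2"

lemma F_descent: "F (\<theta> + v) \<le> F \<theta> + v \<bullet> gradient F \<theta> + L / 2 * (norm v)\<^sup>2"
  by (rule descent_lemma[OF F_differentiable F_lipschitz])

text \<open>A gradient step of length \<open>1 / L\<close> cannot make \<open>F\<close> negative, so
  the squared gradient is at most \<open>2 * L * F \<theta>\<close>; compare with the
  Polyak-Lojasiewicz bound. Together with \<open>L * \<eta> \<le> 1 / 2\<close> this keeps the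
  contraction factor nonnegative.\<close>

lemma PL_le_smoothness:
  assumes "0 < F \<theta>"
  shows "\<mu> \<le> L"
proof -
  define N where "N = (norm (gradient F \<theta>))\<^sup>2"
  have "0 \<le> F (\<theta> + (- 1 / L) *\<^sub>R gradient F \<theta>)"
    by (rule F_nonneg)
  also have "\<dots> \<le> F \<theta> - N / L + L / 2 * (1 / L\<^sup>2 * N)"
    using F_descent[of \<theta> "(- 1 / L) *\<^sub>R gradient F \<theta>"]
    by (simp add: N_def power_mult_distrib power_divide power2_norm_eq_inner)
  also have "\<dots> = F \<theta> - N / (2 * L)"
    using L_pos by (simp add: field_simps power2_eq_square)
  finally have "N \<le> 2 * L * F \<theta>"
    using L_pos by (simp add: field_simps)
  with PL[of \<theta>] have "\<mu> * F \<theta> \<le> L * F \<theta>"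
    unfolding N_def by simp
  then show ?thesis
    using assms by simp
qed

text \<open>A single batch and deterministic points; the results serve for the outer and the inner
  batch alike.\<close>

context
  fixes X :: "nat \<Rightarrow> 'w \<Rightarrow> nat"
  assumes ind: "indep_vars (\<lambda>_. count_space {1..n}) X {1..B}"
    and unif: "\<And>j. j \<in> {1..B} \<Longrightarrow> distr M (count_space {1..n}) (X j) = uniform_count_measure {1..n}"
begin

lemma integrable_batch_grad:
  fixes h :: "real^'p \<Rightarrow> real"
  shows "integrable M (\<lambda>\<omega>. h (batch_grad (\<lambda>j. X j \<omega>) \<theta>))"
  using integrable_finite_range[OF measurable_batch[OF ind], of "\<lambda>b. h (batch_grad b \<theta>)"]
  by (simp add: finite_PiE)

lemma expectation_norm2_batch_grad_le:
  "expectation (\<lambda>\<omega>. (norm (batch_grad (\<lambda>j. X j \<omega>) \<theta>))\<^sup>2) \<le>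
     (norm (gradient F \<theta>))\<^sup>2 + \<sigma>\<^sup>2 * F \<theta> / real B"
  using expectation_norm2_batch_mean[OF ind unif n_pos B_pos gradient_F, of \<theta>]
    divide_right_mono[OF noise[of \<theta>], of "real B"] by simp

text \<open>The cross term of the descent lemma is polarised; what is left of the square of the gradient
  at the perturbed point \<open>u\<close> absorbs the gradient noise there, by the Polyak-Lojasiewicz inequality.\<close>

lemma expectation_outer_step_le:
  "expectation (\<lambda>\<omega>. F (\<theta> - \<eta> *\<^sub>R batch_grad (\<lambda>j. X j \<omega>) u)) \<le> perturbed_bound \<theta> u"
proof -
  define m where "m = (\<lambda>\<omega>. batch_grad (\<lambda>j. X j \<omega>) u)"
  let ?G = "gradient F \<theta>" and ?U = "gradient F u"
  have int: "integrable M (\<lambda>\<omega>. h (m \<omega>))" for h :: "real^'p \<Rightarrow> real"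
    unfolding m_def by (rule integrable_batch_grad)
  have "expectation (\<lambda>\<omega>. F (\<theta> - \<eta> *\<^sub>R m \<omega>)) \<le>
      expectation (\<lambda>\<omega>. F \<theta> - \<eta> * (?G \<bullet> m \<omega>) + L * \<eta>\<^sup>2 / 2 * (norm (m \<omega>))\<^sup>2)"
  proof (rule integral_mono)
    show "F (\<theta> - \<eta> *\<^sub>R m \<omega>) \<le> F \<theta> - \<eta> * (?G \<bullet> m \<omega>) + L * \<eta>\<^sup>2 / 2 * (norm (m \<omega>))\<^sup>2" for \<omega>
      using F_descent[of \<theta> "- \<eta> *\<^sub>R m \<omega>"]
      by (simp add: power_mult_distrib inner_commute mult_ac)
  qed (rule int[of "\<lambda>v. F (\<theta> - \<eta> *\<^sub>R v)"] int[of "\<lambda>v. F \<theta> - \<eta> * (?G \<bullet> v) + L * \<eta>\<^sup>2 / 2 * (norm v)\<^sup>2"])+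
  also have "\<dots> = F \<theta> - \<eta> * expectation (\<lambda>\<omega>. ?G \<bullet> m \<omega>) +
      L * \<eta>\<^sup>2 / 2 * expectation (\<lambda>\<omega>. (norm (m \<omega>))\<^sup>2)"
    using int[of "\<lambda>v. ?G \<bullet> v"] int[of "\<lambda>v. (norm v)\<^sup>2"] by (simp add: prob_space)
  also have "expectation (\<lambda>\<omega>. ?G \<bullet> m \<omega>) = ?G \<bullet> ?U"
    unfolding m_def by (rule expectation_inner_batch_mean[OF ind unif n_pos B_pos gradient_F])
  also have "F \<theta> - \<eta> * (?G \<bullet> ?U) + L * \<eta>\<^sup>2 / 2 * expectation (\<lambda>\<omega>. (norm (m \<omega>))\<^sup>2) \<le>
      F \<theta> - \<eta> * (?G \<bullet> ?U) + L * \<eta>\<^sup>2 / 2 * ((norm ?U)\<^sup>2 + \<sigma>\<^sup>2 * F u / real B)"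
    using expectation_norm2_batch_grad_le[of u] L_pos unfolding m_def
    by (intro add_left_mono mult_left_mono) auto
  \<comment> \<open>The squared gradient takes the share 1/2 and the noise, through
    Polyak-Lojasiewicz at \<open>u\<close>, the share 1/4; the factor \<open>\<eta> / 2\<close>
    turns 3/4 into 3/8.\<close>
  also have "L * \<eta>\<^sup>2 / 2 * ((norm ?U)\<^sup>2 + \<sigma>\<^sup>2 * F u / real B) \<le> 3 / 8 * \<eta> * (norm ?U)\<^sup>2"
  proof -
    have "L * \<eta> * (norm ?U)\<^sup>2 \<le> 1 / 2 * (norm ?U)\<^sup>2"
      by (rule mult_right_mono[OF \<eta>_le(1)]) simp
    moreover have "L * \<eta> * \<sigma>\<^sup>2 * (F u / real B) \<le> \<mu> * real B / 2 * (F u / real B)"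
      using F_nonneg by (intro mult_right_mono[OF \<eta>_le(2)]) simp
    then have "L * \<eta> * (\<sigma>\<^sup>2 * F u / real B) \<le> \<mu> * F u / 2"
      using B_pos by (simp add: field_simps)
    then have "L * \<eta> * (\<sigma>\<^sup>2 * F u / real B) \<le> 1 / 4 * (norm ?U)\<^sup>2"
      using PL[of u] by linarith
    ultimately have "L * \<eta> * ((norm ?U)\<^sup>2 + \<sigma>\<^sup>2 * F u / real B) \<le> 3 / 4 * (norm ?U)\<^sup>2"
      by (simp add: distrib_left)
    then have "\<eta> / 2 * (L * \<eta> * ((norm ?U)\<^sup>2 + \<sigma>\<^sup>2 * F u / real B)) \<le> \<eta> / 2 * (3 / 4 * (norm ?U)\<^sup>2)"
      using \<eta>_pos by (intro mult_left_mono) auto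
    then show ?thesis
      by (simp add: power2_eq_square mult_ac)
  qed
  \<comment> \<open>Polarising the inner product gives the squared norm of \<open>?U\<close> the
    coefficient \<open>- \<eta> / 2\<close>, and 3/8 - 1/2 = -1/8.\<close>
  also have "F \<theta> - \<eta> * (?G \<bullet> ?U) + 3 / 8 * \<eta> * (norm ?U)\<^sup>2 =
      perturbed_bound \<theta> u - \<eta> / 8 * (norm ?U)\<^sup>2"
    unfolding perturbed_bound_def
    by (simp add: power2_norm_eq_inner inner_diff_left inner_diff_right inner_commute field_simps)
  also have "\<dots> \<le> perturbed_bound \<theta> u"
    using \<eta>_pos by simp
  finally show ?thesis
    unfolding m_def by simp
qed

text \<open>The displacement from \<open>\<theta>\<close> is \<open>\<rho>\<close> times the inner
  batch gradient, so the Lipschitz property leaves only the second moment of that gradient to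
  control.\<close>

lemma expectation_perturbed_bound_le:
  "expectation (\<lambda>\<omega>. perturbed_bound \<theta> (\<theta> + \<rho> *\<^sub>R batch_grad (\<lambda>j. X j \<omega>) \<theta>)) \<le>
     (1 - \<eta> * \<mu> / 2) * F \<theta>"
proof -
  define m where "m = (\<lambda>\<omega>. batch_grad (\<lambda>j. X j \<omega>) \<theta>)"
  define N where "N = (norm (gradient F \<theta>))\<^sup>2"
  have int: "integrable M (\<lambda>\<omega>. h (m \<omega>))" for h :: "real^'p \<Rightarrow> real"
    unfolding m_def by (rule integrable_batch_grad)
  have "expectation (\<lambda>\<omega>. perturbed_bound \<theta> (\<theta> + \<rho> *\<^sub>R m \<omega>)) \<le>
      expectation (\<lambda>\<omega>. F \<theta> - \<eta> / 2 * N + \<eta> / 2 * ((L * \<rho>)\<^sup>2 * (norm (m \<omega>))\<^sup>2))"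
  proof (rule integral_mono)
    fix \<omega>
    have "norm (gradient F (\<theta> + \<rho> *\<^sub>R m \<omega>) - gradient F \<theta>) \<le> L * \<rho> * norm (m \<omega>)"
      using F_lipschitz[of "\<theta> + \<rho> *\<^sub>R m \<omega>" \<theta>] \<rho>_nonneg by simp
    then have "(norm (gradient F (\<theta> + \<rho> *\<^sub>R m \<omega>) - gradient F \<theta>))\<^sup>2 \<le> (L * \<rho>)\<^sup>2 * (norm (m \<omega>))\<^sup>2"
      unfolding power_mult_distrib[symmetric] by (intro power_mono) auto
    then show "perturbed_bound \<theta> (\<theta> + \<rho> *\<^sub>R m \<omega>) \<le>
        F \<theta> - \<eta> / 2 * N + \<eta> / 2 * ((L * \<rho>)\<^sup>2 * (norm (m \<omega>))\<^sup>2)"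
      unfolding perturbed_bound_def N_def using \<eta>_pos by (intro add_left_mono mult_left_mono) auto
  qed (rule int[of "\<lambda>v. perturbed_bound \<theta> (\<theta> + \<rho> *\<^sub>R v)"]
        int[of "\<lambda>v. F \<theta> - \<eta> / 2 * N + \<eta> / 2 * ((L * \<rho>)\<^sup>2 * (norm v)\<^sup>2)"])+
  also have "\<dots> = F \<theta> - \<eta> / 2 * N + \<eta> / 2 * ((L * \<rho>)\<^sup>2 * expectation (\<lambda>\<omega>. (norm (m \<omega>))\<^sup>2))"
    using int[of "\<lambda>v. (norm v)\<^sup>2"] by (simp add: prob_space)
  also have "(L * \<rho>)\<^sup>2 * expectation (\<lambda>\<omega>. (norm (m \<omega>))\<^sup>2) \<le> (L * \<rho>)\<^sup>2 * (N + \<sigma>\<^sup>2 * F \<theta> / real B)"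
    unfolding N_def m_def by (intro mult_left_mono expectation_norm2_batch_grad_le) simp
  \<comment> \<open>One factor \<open>L * \<rho>\<close> is spent on the two summands through the
    two bounds in \<open>\<rho>_le\<close>; the other supplies the leading 1/4.\<close>
  also have "\<dots> \<le> 1 / 4 * (1 / 4 * N + \<mu> / 4 * F \<theta>)"
  proof -
    have "L * \<rho> * N \<le> 1 / 4 * N"
      by (rule mult_right_mono[OF \<rho>_le(1)]) (simp add: N_def)
    moreover have "L * \<rho> * \<sigma>\<^sup>2 * (F \<theta> / real B) \<le> \<mu> * real B / 4 * (F \<theta> / real B)"
      using F_nonneg by (intro mult_right_mono[OF \<rho>_le(2)]) simp
    then have "L * \<rho> * (\<sigma>\<^sup>2 * F \<theta> / real B) \<le> \<mu> / 4 * F \<theta>"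
      using B_pos by (simp add: field_simps)
    ultimately have "L * \<rho> * (N + \<sigma>\<^sup>2 * F \<theta> / real B) \<le> 1 / 4 * N + \<mu> / 4 * F \<theta>"
      unfolding distrib_left by linarith
    moreover have "0 \<le> L * \<rho> * (N + \<sigma>\<^sup>2 * F \<theta> / real B)"
      using L_pos \<rho>_nonneg F_nonneg by (simp add: N_def)
    ultimately have "L * \<rho> * (L * \<rho> * (N + \<sigma>\<^sup>2 * F \<theta> / real B)) \<le> 1 / 4 * (1 / 4 * N + \<mu> / 4 * F \<theta>)"
      by (intro mult_mono \<rho>_le(1)) auto
    then show ?thesis
      by (simp add: power2_eq_square mult.assoc)
  qed
  finally have "expectation (\<lambda>\<omega>. perturbed_bound \<theta> (\<theta> + \<rho> *\<^sub>R m \<omega>)) \<le>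
      F \<theta> - \<eta> / 2 * (N - (1 / 16 * N + \<mu> / 16 * F \<theta>))"
    using \<eta>_pos by (simp add: field_simps)
  \<comment> \<open>By Polyak-Lojasiewicz, 15/16 of \<open>N\<close> is at least 15/8 of
    \<open>\<mu> * F \<theta>\<close>, and 17/16 would suffice.\<close>
  also have "\<dots> \<le> F \<theta> - \<eta> / 2 * (\<mu> * F \<theta>)"
  proof -
    have "0 \<le> \<mu> * F \<theta>"
      using \<mu>_pos F_nonneg by simp
    then have "\<mu> * F \<theta> \<le> N - (1 / 16 * N + \<mu> / 16 * F \<theta>)"
      using PL[of \<theta>] unfolding N_def[symmetric] by simp
    then show ?thesis
      using \<eta>_pos by (intro diff_left_mono mult_left_mono) auto
  qed
  finally show ?thesis
    unfolding m_def by (simp add: field_simps)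
qed

end

end

section \<open>Dependence of the iterates on the batches, and the final recursion\<close>

text \<open>Each iterate reads only batches of earlier steps, at the positions
  \<open>{1..B}\<close>. This is what makes it a function of the past, to be separated from the
  batches of the current step.\<close>

lemma stochastic_sam_cong:
  assumes "\<And>s t' j. s \<in> {1, 2} \<Longrightarrow> t' < t \<Longrightarrow> j \<in> {1..B} \<Longrightarrow> \<xi> s t' j = \<xi>' s t' j"
  shows "stochastic_sam f x y B \<eta> \<rho> \<theta>0 \<xi> t = stochastic_sam f x y B \<eta> \<rho> \<theta>0 \<xi>' t"
  using assms
proof (induction t)
  case (Suc t)
  then have "gradient (batch_loss f x y B (\<xi> s t)) = gradient (batch_loss f x y B (\<xi>' s t))"
    if "s \<in> {1, 2}" for s
    using that by (intro gradient_batch_loss_cong) auto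
  moreover have "stochastic_sam f x y B \<eta> \<rho> \<theta>0 \<xi> t = stochastic_sam f x y B \<eta> \<rho> \<theta>0 \<xi>' t"
    using Suc by simp
  ultimately show ?case
    by (simp add: Let_def)
qed simp

theorem theorem4p3:
  fixes f :: "real^'d \<Rightarrow> real^'p \<Rightarrow> real"
    and x :: "nat \<Rightarrow> real^'d" and y :: "nat \<Rightarrow> real" and n B :: nat
    and L \<mu> \<sigma> \<eta> \<rho> :: real and \<theta>0 :: "real^'p"
    and M :: "'w measure" and \<xi> :: "nat \<Rightarrow> nat \<Rightarrow> nat \<Rightarrow> 'w \<Rightarrow> nat"
  assumes "n \<ge> 1"
    and "\<And>i. i \<in> {1..n} \<Longrightarrow> twice_differentiable (f (x i))"
    and "\<exists>\<theta>min. loss f x y n \<theta>min = 0 \<and> (\<forall>\<theta>. loss f x y n \<theta>min \<le> loss f x y n \<theta>)"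
    and "L > 0" and "\<mu> > 0" and "\<sigma> > 0"
    and "\<And>\<theta>. spectral_norm (hessian (loss f x y n) \<theta>) \<le> L"
    and "\<And>\<theta>. (norm (gradient (loss f x y n) \<theta>))\<^sup>2 \<ge> 2 * \<mu> * loss f x y n \<theta>"
    and "\<And>\<theta>. 1 / real n * (\<Sum>i=1..n. (norm (gradient (sample_loss f x y i) \<theta>
                                             - gradient (loss f x y n) \<theta>))\<^sup>2)
               \<le> \<sigma>\<^sup>2 * loss f x y n \<theta>"
    and "\<eta> > 0" and "\<rho> \<ge> 0" and "B \<ge> 1"
    and "prob_space M"
    and "prob_space.independent_uniform_batches M n B \<xi>"
    and "\<eta> \<le> Min {1 / (2 * L), \<mu> * real B / (2 * L * \<sigma>\<^sup>2)}"
    and "\<rho> \<le> Min {1 / (4 * L), \<mu> * real B / (4 * L * \<sigma>\<^sup>2), \<eta> * \<mu>\<^sup>2 / (24 * L\<^sup>2)}"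
  shows "\<forall>t. integrable M (\<lambda>\<omega>. loss f x y n
                  (stochastic_sam f x y B \<eta> \<rho> \<theta>0 (\<lambda>s t j. \<xi> s t j \<omega>) t)) \<and>
             prob_space.expectation M (\<lambda>\<omega>. loss f x y n
                  (stochastic_sam f x y B \<eta> \<rho> \<theta>0 (\<lambda>s t j. \<xi> s t j \<omega>) t))
               \<le> (1 - \<eta> * \<mu> / 2) ^ t * loss f x y n \<theta>0"
proof -
  interpret prob_space M by (fact assms(13))
  define F where "F = loss f x y n"
  define g where "g = (\<lambda>i. gradient (sample_loss f x y i))"
  define c where "c = 1 - \<eta> * \<mu> / 2"
  have td: "twice_differentiable (f (x i))" if "i \<in> {1..n}" for i
    by (rule assms(2)[OF that])
  have td_F: "twice_differentiable F"
    unfolding F_def loss_eq_batch_loss by (rule twice_differentiable_batch_loss) (simp add: td)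
  have \<eta>_bounds: "\<eta> \<le> 1 / (2 * L)" "\<eta> \<le> \<mu> * real B / (2 * L * \<sigma>\<^sup>2)"
    and \<rho>_bounds: "\<rho> \<le> 1 / (4 * L)" "\<rho> \<le> \<mu> * real B / (4 * L * \<sigma>\<^sup>2)"
    using assms(15,16) by auto
  interpret sam_objective M F g n B L \<mu> \<sigma> \<eta> \<rho>
  proof
    show "0 \<le> F \<theta>" for \<theta>
      unfolding F_def loss_def sample_loss_def by (intro mult_nonneg_nonneg sum_nonneg) auto
    show "F differentiable (at \<theta>)" for \<theta>
      using td_F unfolding twice_differentiable_def by blast
    show "norm (gradient F \<theta> - gradient F \<theta>') \<le> L * norm (\<theta> - \<theta>')" for \<theta> \<theta>'
      by (rule gradient_lipschitz[OF td_F assms(7)[folded F_def]])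
    show "gradient F \<theta> = (1 / real n) *\<^sub>R (\<Sum>i=1..n. g i \<theta>)" for \<theta>
      unfolding F_def loss_eq_batch_loss g_def by (subst gradient_batch_loss) (simp_all add: td)
    show "L * \<eta> \<le> 1 / 2" "L * \<eta> * \<sigma>\<^sup>2 \<le> \<mu> * real B / 2"
      "L * \<rho> \<le> 1 / 4" "L * \<rho> * \<sigma>\<^sup>2 \<le> \<mu> * real B / 4"
      using \<eta>_bounds \<rho>_bounds assms(4,6) by (simp_all add: field_simps)
  qed (use assms in \<open>simp_all add: F_def g_def\<close>)
  \<comment> \<open>Restricted batches take values in the finite set \<open>E\<close>; the family
    \<open>X\<close>, indexed by kind and step, carries all the randomness of the iteration.\<close>
  define E where "E = {1..B} \<rightarrow>\<^sub>E {1..n}"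
  define X where "X = (\<lambda>(s, t) \<omega>. \<lambda>j\<in>{1..B}. \<xi> s t j \<omega>)"
  have "finite E"
    unfolding E_def by (simp add: finite_PiE)
  have "(\<Pi>\<^sub>M j\<in>{1..B}. count_space {1..n}) = count_space E"
    unfolding E_def by (simp add: count_space_PiM_finite)
  then have ind_X: "indep_vars (\<lambda>_. count_space E) X ({1, 2} \<times> UNIV)"
    and ind: "\<And>s t. s \<in> {1, 2} \<Longrightarrow> indep_vars (\<lambda>_. count_space {1..n}) (\<xi> s t) {1..B}"
    and unif: "\<And>s t j. s \<in> {1, 2} \<Longrightarrow> j \<in> {1..B} \<Longrightarrow>
      distr M (count_space {1..n}) (\<xi> s t j) = uniform_count_measure {1..n}"
    using assms(14) unfolding independent_uniform_batches_def X_def by auto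
  \<comment> \<open>Disjoint finite groups of batches are independent and again discrete of finite
    range, as the finite Fubini lemma requires.\<close>
  have ind_restrict: "indep_var (count_space (A \<rightarrow>\<^sub>E E)) (\<lambda>\<omega>. restrict (\<lambda>p. X p \<omega>) A)
      (count_space (A' \<rightarrow>\<^sub>E E)) (\<lambda>\<omega>. restrict (\<lambda>p. X p \<omega>) A')"
    if "A \<inter> A' = {}" "A \<subseteq> {1, 2} \<times> UNIV" "A' \<subseteq> {1, 2} \<times> UNIV" "finite A" "finite A'" for A A'
    using indep_var_restrict[OF ind_X that(1-3)] that(4,5) \<open>finite E\<close>
    by (simp add: count_space_PiM_finite countable_finite)
  have fin: "finite (A \<rightarrow>\<^sub>E E)" if "finite A" for A :: "(nat \<times> nat) set"
    using that \<open>finite E\<close> by (simp add: finite_PiE)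
  \<comment> \<open>Only for outcomes in \<open>space M\<close> are the drawn indices known to lie
    in \<open>{1..n}\<close>, where differentiability of the model is given.\<close>
  have batch: "gradient (batch_loss f x y B (X (s, t) \<omega>)) \<theta> = batch_grad (\<lambda>j. \<xi> s t j \<omega>) \<theta>"
    if "s \<in> {1, 2}" "\<omega> \<in> space M" for s t \<omega> \<theta>
  proof -
    have "\<xi> s t j \<omega> \<in> {1..n}" if "j \<in> {1..B}" for j
    proof -
      have "\<xi> s t j \<in> measurable M (count_space {1..n})"
        using ind[OF \<open>s \<in> {1, 2}\<close>, of t] that unfolding indep_vars_def by blast
      from measurable_space[OF this \<open>\<omega> \<in> space M\<close>] show ?thesis by simp
    qed
    then have "gradient (batch_loss f x y B (\<lambda>j. \<xi> s t j \<omega>)) \<theta> = batch_grad (\<lambda>j. \<xi> s t j \<omega>) \<theta>"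
      unfolding g_def by (intro gradient_batch_loss td)
    moreover have "gradient (batch_loss f x y B (X (s, t) \<omega>)) =
        gradient (batch_loss f x y B (\<lambda>j. \<xi> s t j \<omega>))"
      by (rule gradient_batch_loss_cong) (simp add: X_def)
    ultimately show ?thesis by simp
  qed
  \<comment> \<open>\<open>\<Theta>\<close> is the iterate as a deterministic function of a family
    of batches, \<open>\<theta>\<close> the iterate as a random variable; they agree once the family
    covers all earlier steps.\<close>
  define \<Theta> where "\<Theta> = (\<lambda>(h :: nat \<times> nat \<Rightarrow> nat \<Rightarrow> nat) t.
    stochastic_sam f x y B \<eta> \<rho> \<theta>0 (\<lambda>s t. h (s, t)) t)"
  define \<theta> where "\<theta> = (\<lambda>t \<omega>. stochastic_sam f x y B \<eta> \<rho> \<theta>0 (\<lambda>s t j. \<xi> s t j \<omega>) t)"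
  have \<Theta>: "\<Theta> (restrict (\<lambda>p. X p \<omega>) A) t = \<theta> t \<omega>" if "{1, 2} \<times> {..<t} \<subseteq> A" for A t \<omega>
    unfolding \<Theta>_def \<theta>_def using that by (intro stochastic_sam_cong) (auto simp: X_def)
  have integrable: "integrable M (\<lambda>\<omega>. F (\<theta> t \<omega>))" for t
  proof -
    have "(\<lambda>\<omega>. restrict (\<lambda>p. X p \<omega>) ({1, 2} \<times> {..<t})) \<in>
        measurable M (count_space ({1, 2} \<times> {..<t} \<rightarrow>\<^sub>E E))"
      \<comment> \<open>Measurability of the past is read off from its independence of the empty
        group.\<close>
      by (rule indep_var_rv1[OF ind_restrict[of _ "{}"]]) auto
    from integrable_finite_range[OF this fin, of "\<lambda>h. F (\<Theta> h t)"] show ?thesis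
      by (simp add: \<Theta>)
  qed
  have step: "expectation (\<lambda>\<omega>. F (\<theta> (Suc t) \<omega>)) \<le> c * expectation (\<lambda>\<omega>. F (\<theta> t \<omega>))" for t
  proof -
    define A :: "(nat \<times> nat) set" where "A = {1, 2} \<times> {..<t}"
    define H where "H = (\<lambda>A \<omega>. restrict (\<lambda>p. X p \<omega>) A)"
    define u where "u = (\<lambda>\<theta> b. \<theta> + \<rho> *\<^sub>R gradient (batch_loss f x y B b) \<theta>)"
    define k :: "_ \<Rightarrow> (nat \<times> nat \<Rightarrow> nat \<Rightarrow> nat) \<Rightarrow> real" where "k = (\<lambda>h h'. F (\<Theta> h t -
      \<eta> *\<^sub>R gradient (batch_loss f x y B (h' (1, t))) (u (\<Theta> h t) (h (2, t)))))"
    \<comment> \<open>\<open>\<Phi>\<close> reads the inner batch from the same family as the past,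
      \<open>\<Psi>\<close> from a separate argument.\<close>
    define \<Phi> where "\<Phi> = (\<lambda>h. perturbed_bound (\<Theta> h t) (u (\<Theta> h t) (h (2, t))))"
    define \<Psi> :: "_ \<Rightarrow> (nat \<times> nat \<Rightarrow> nat \<Rightarrow> nat) \<Rightarrow> real" where "\<Psi> = (\<lambda>h h'. perturbed_bound (\<Theta> h t) (u (\<Theta> h t) (h' (2, t))))"
    let ?A2 = "insert (2, t) A"
    have "finite A"
      unfolding A_def by simp
    \<comment> \<open>The outer batch is averaged first, with the inner batch counted as part of the
      past; \<open>ind2\<close> then splits the inner batch off.\<close>
    have ind1: "indep_var (count_space (?A2 \<rightarrow>\<^sub>E E)) (H ?A2) (count_space ({(1, t)} \<rightarrow>\<^sub>E E)) (H {(1, t)})"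
      unfolding H_def A_def by (intro ind_restrict) auto
    have ind2: "indep_var (count_space (A \<rightarrow>\<^sub>E E)) (H A) (count_space ({(2, t)} \<rightarrow>\<^sub>E E)) (H {(2, t)})"
      unfolding H_def A_def by (intro ind_restrict) auto
    have \<Theta>_H: "\<Theta> (H ?A2 \<omega>) t = \<theta> t \<omega>" "\<Theta> (H A \<omega>) t = \<theta> t \<omega>" for \<omega>
      unfolding H_def by (intro \<Theta>; auto simp: A_def)+
    have H_at: "H A' \<omega> p = X p \<omega>" if "p \<in> A'" for A' \<omega> p
      using that by (simp add: H_def)
    have fins: "finite (?A2 \<rightarrow>\<^sub>E E)" "finite (A \<rightarrow>\<^sub>E E)" 
      "finite ({(1 :: nat, t)} \<rightarrow>\<^sub>E E)" "finite ({(2 :: nat, t)} \<rightarrow>\<^sub>E E)"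
      using \<open>finite A\<close> by (intro fin; simp)+
    note int_A2 = integrable_finite_range[OF indep_var_rv1[OF ind1] fins(1)]
    note int_A = integrable_finite_range[OF indep_var_rv1[OF ind2] fins(2)]
    have "F (\<theta> (Suc t) \<omega>) = k (H ?A2 \<omega>) (H {(1, t)} \<omega>)" for \<omega>
    proof -
      have "gradient (batch_loss f x y B (X (s, t) \<omega>)) = gradient (batch_loss f x y B (\<lambda>j. \<xi> s t j \<omega>))" for s
        by (rule gradient_batch_loss_cong) (simp add: X_def)
      then show ?thesis
        unfolding k_def u_def \<Theta>_H by (simp add: H_at \<theta>_def Let_def)
    qed
    then have "expectation (\<lambda>\<omega>. F (\<theta> (Suc t) \<omega>)) =
        expectation (\<lambda>\<omega>. expectation (\<lambda>\<omega>'. k (H ?A2 \<omega>) (H {(1, t)} \<omega>')))"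
      using expectation_indep_finite_range[OF ind1 fins(1,3), of k] by simp
    also have "\<dots> \<le> expectation (\<lambda>\<omega>. \<Phi> (H ?A2 \<omega>))"
    proof (rule integral_mono)
      fix \<omega>
      \<comment> \<open>With \<open>\<omega>\<close> fixed, the iterate and the perturbed point are
        deterministic and only the outer batch varies with \<open>\<omega>'\<close>, so the one-step
        bound applies.\<close>
      have "expectation (\<lambda>\<omega>'. k (H ?A2 \<omega>) (H {(1, t)} \<omega>')) =
          expectation (\<lambda>\<omega>'. F (\<theta> t \<omega> - \<eta> *\<^sub>R batch_grad (\<lambda>j. \<xi> 1 t j \<omega>') (u (\<theta> t \<omega>) (X (2, t) \<omega>))))"
        by (intro Bochner_Integration.integral_cong refl) (simp add: k_def \<Theta>_H H_at batch)
      also have "\<dots> \<le> \<Phi> (H ?A2 \<omega>)"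
        unfolding \<Phi>_def \<Theta>_H using expectation_outer_step_le[OF ind unif] by (simp add: H_at)
      finally show "expectation (\<lambda>\<omega>'. k (H ?A2 \<omega>) (H {(1, t)} \<omega>')) \<le> \<Phi> (H ?A2 \<omega>)" .
    qed (rule int_A2)+
    \<comment> \<open>Nothing is estimated here: the inner batch moves to its own argument for the
      second use of Fubini.\<close>
    also have "\<dots> = expectation (\<lambda>\<omega>. \<Psi> (H A \<omega>) (H {(2, t)} \<omega>))"
      unfolding \<Phi>_def \<Psi>_def \<Theta>_H by (simp add: H_at)
    also have "\<dots> = expectation (\<lambda>\<omega>. expectation (\<lambda>\<omega>'. \<Psi> (H A \<omega>) (H {(2, t)} \<omega>')))"
      by (rule expectation_indep_finite_range[OF ind2 fins(2,4)])
    also have "\<dots> \<le> expectation (\<lambda>\<omega>. c * F (\<theta> t \<omega>))"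
    proof (rule integral_mono)
      fix \<omega>
      have "expectation (\<lambda>\<omega>'. \<Psi> (H A \<omega>) (H {(2, t)} \<omega>')) =
          expectation (\<lambda>\<omega>'. perturbed_bound (\<theta> t \<omega>) (\<theta> t \<omega> + \<rho> *\<^sub>R batch_grad (\<lambda>j. \<xi> 2 t j \<omega>') (\<theta> t \<omega>)))"
        by (intro Bochner_Integration.integral_cong refl) (simp add: \<Psi>_def u_def \<Theta>_H H_at batch)
      also have "\<dots> \<le> c * F (\<theta> t \<omega>)"
        unfolding c_def by (rule expectation_perturbed_bound_le[OF ind unif]) auto
      finally show "expectation (\<lambda>\<omega>'. \<Psi> (H A \<omega>) (H {(2, t)} \<omega>')) \<le> c * F (\<theta> t \<omega>)" .
    qed (rule int_A integrable_mult_right integrable)+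
    finally show ?thesis by simp
  qed
  have bound: "expectation (\<lambda>\<omega>. F (\<theta> t \<omega>)) \<le> c ^ t * F \<theta>0" for t
  proof (induction t)
    case 0
    show ?case by (simp add: \<theta>_def prob_space)
  next
    case (Suc t)
    have "c * expectation (\<lambda>\<omega>. F (\<theta> t \<omega>)) \<le> c * (c ^ t * F \<theta>0)"
      \<comment> \<open>\<open>c\<close> may be negative if the loss vanishes identically\<close>
    proof (cases "\<exists>\<theta>. 0 < F \<theta>")
      case True
      then have "\<mu> \<le> L"
        using PL_le_smoothness by blast
      then have "\<eta> * \<mu> \<le> \<eta> * L"
        using \<eta>_pos by simp
      then have "0 \<le> c"
        using \<eta>_le(1) unfolding c_def by (simp add: mult.commute)
      then show ?thesis
        by (rule mult_left_mono[OF Suc])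
    next
      case False
      then have "F \<theta> = 0" for \<theta>
        using F_nonneg by (metis order_le_less)
      then show ?thesis by simp
    qed
    with step[of t] show ?case by (simp add: mult.assoc)
  qed
  show ?thesis
    using integrable bound unfolding F_def \<theta>_def c_def by blast
qed

end
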